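(* Let $m\ge 1$ be an integer, let $d=3(m-1)$, and let $H(m,2)=(H(m,2)_i)_{0\le i\le d}$ be the Hilbert function of the graded algebra $A(m,2)$. Then for every $0\le i\le d$, $$H(m,2)_i=\left\lfloor\frac{i+2}{2}\right\rfloor-\left\lfloor\frac{i+2-m}{2}\right\rfloor_\star-\left\lfloor\frac{i+2-2m}{2}\right\rfloor_\star .$$ If $m=2m'$ is even, then $$H(m,2)=(1,1,2,2,\ldots,m'-1,m'-1,\underbrace{m',m',\ldots,m',m'}_{m+2\text{ terms}},m'-1,m'-1,\ldots,2,2,1,1),$$ and if $m=2m'-1$ is odd, then $$H(m,2)=(1,1,2,2,\ldots,m'-1,m'-1,\underbrace{m',m'-1,\ldots,m'-1,m'}_{m\text{ terms}},m'-1,m'-1,\ldots,2,2,1,1),$$ where the $m$ middle terms alternate between $m'$ and $m'-1$, beginning and ending with $m'$. In particular, $H(m,2)$ is unimodal if and only if $m$ is even.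
   Context: Let $e_1=x_1+x_2$ and $e_2=x_1x_2$ in $\mathbb{Q}[x_1,x_2]$, so that $\mathbb{Q}[e_1,e_2]$ is the polynomial ring of symmetric polynomials, graded by $\deg(e_1)=1$, $\deg(e_2)=2$. Let $e_1(m)=x_1^m+x_2^m$ and $e_2(m)=x_1^mx_2^m$, viewed as elements of $\mathbb{Q}[e_1,e_2]$. The algebra $A(m,2)$ is the graded quotient $A(m,2)=\mathbb{Q}[e_1,e_2]/(e_1(m),e_2(m))$, a graded Artinian complete intersection of socle degree $d=3(m-1)$. Its Hilbert function is $H(m,2)_i=\dim_{\mathbb{Q}}(A(m,2)_i)$. Notation: $\lfloor x\rfloor_\star=\max(0,\lfloor x\rfloor)$. A finite sequence is unimodal if it is weakly increasing up to some index and weakly decreasing afterwards.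
   Formalization: The final claim that H(m,2) is unimodal if and only if m is even is stated only for m ≥ 2, since for m = 1 the sequence is (1), which is unimodal although m is odd. *)

theory Defs
  imports
    "HOL-Computational_Algebra.Polynomial"
    "HOL-Algebra.QuotRing"
    "HOL-Algebra.Generated_Rings"
    "HOL-Algebra.Embedded_Algebras"
    "HOL-Algebra.Algebraic_Closure_Type"
begin

text \<open>
  The polynomial ring in \<open>x\<^sub>1, x\<^sub>2\<close> over the rationals is modelled by the type
  \<^typ>\<open>rat poly poly\<close>: the inner variable is \<open>x\<^sub>1\<close>, the outer one is \<open>x\<^sub>2\<close>.
\<close>

definition x1 :: "rat poly poly" where
  "x1 = [:[:0, 1:]:]"

definition x2 :: "rat poly poly" where
  "x2 = [:0, 1:]"

definition const_poly :: "rat \<Rightarrow> rat poly poly" where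
  "const_poly c = [:[:c:]:]"

definition e1 :: "nat \<Rightarrow> rat poly poly" where
  "e1 m = x1 ^ m + x2 ^ m"

definition e2 :: "nat \<Rightarrow> rat poly poly" where
  "e2 m = x1 ^ m * x2 ^ m"

text \<open>
  \<open>e1 1\<close> and \<open>e2 1\<close> are the elementary symmetric polynomials; \<open>Sym2\<close> is the
  subring generated by them and the rational constants.
\<close>

definition Sym2 :: "rat poly poly ring" where
  "Sym2 = (ring_of_type_algebra :: rat poly poly ring)
     \<lparr>carrier := generate_ring ring_of_type_algebra (range const_poly \<union> {e1 1, e2 1})\<rparr>"

text \<open>The homogeneous component of degree \<open>i\<close> for \<open>deg e\<^sub>1 = 1\<close>, \<open>deg e\<^sub>2 = 2\<close>.\<close>

definition Sym2_comp :: "nat \<Rightarrow> rat poly poly set" where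
  "Sym2_comp i =
     {(\<Sum>(a, b)\<in>{(a, b). a + 2 * b = i}. const_poly (c a b) * e1 1 ^ a * e2 1 ^ b)
      | c :: nat \<Rightarrow> nat \<Rightarrow> rat. True}"

text \<open>The defining ideal is generated inside \<^const>\<open>Sym2\<close>, not in the full polynomial ring.\<close>

definition power_ideal :: "nat \<Rightarrow> rat poly poly set" where
  "power_ideal m = Idl\<^bsub>Sym2\<^esub> {e1 m, e2 m}"

definition A2 :: "nat \<Rightarrow> rat poly poly set ring" where
  "A2 m = Sym2 Quot power_ideal m"

text \<open>The scalars and the graded components of the quotient are the images of those of
  \<^const>\<open>Sym2\<close>.\<close>

definition A2_scalars :: "nat \<Rightarrow> rat poly poly set set" where
  "A2_scalars m = range (\<lambda>c. power_ideal m +>\<^bsub>Sym2\<^esub> const_poly c)"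

definition A2_comp :: "nat \<Rightarrow> nat \<Rightarrow> rat poly poly set set" where
  "A2_comp m i = (\<lambda>f. power_ideal m +>\<^bsub>Sym2\<^esub> f) ` Sym2_comp i"

definition hilbert2 :: "nat \<Rightarrow> nat \<Rightarrow> nat" where
  "hilbert2 m i = ring.dim (A2 m) (A2_scalars m) (A2_comp m i)"

definition floor_star :: "real \<Rightarrow> int" where
  "floor_star x = max 0 \<lfloor>x\<rfloor>"

definition unimodal :: "nat list \<Rightarrow> bool" where
  "unimodal xs \<longleftrightarrow> (\<exists>k. sorted (take (Suc k) xs) \<and> sorted_wrt (\<ge>) (drop k xs))"

definition doubled :: "nat list \<Rightarrow> nat list" where
  "doubled xs = concat (map (\<lambda>k. [k, k]) xs)"

end

theory Submission
  imports Defs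
begin

text \<open>
  Write \<open>[p, q] = x\<^sub>1\<^sup>p x\<^sub>2\<^sup>q + x\<^sub>1\<^sup>q x\<^sub>2\<^sup>p\<close> (\<open>symmon\<close>). For \<open>p + q = i\<close> these polynomials span the
  symmetric forms of degree \<open>i\<close>, and multiplication by the two generators of the ideal
  follows the rules
  \<open>e\<^sub>1(m) [p, q] = [p + m, q] + [p, q + m]\<close> and \<open>e\<^sub>2(m) [p, q] = [p + m, q + m]\<close>.
  Modulo the ideal, \<open>[p, q]\<close> therefore vanishes if both exponents are at least \<open>m\<close>, and
  \<open>[p + m, q] = - [p, q + m]\<close>. The latter rule is used to rewrite its left-hand side for
  \<open>q \<le> p\<close>, that is, to get rid of those \<open>[i - q, q]\<close> for which \<open>m + 2 q \<le> i\<close>.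
  In degrees \<open>i < 3 m\<close> a single rewriting step suffices
  (for \<open>p = q\<close> it says that \<open>[p + m, p]\<close> vanishes). What remains are the classes of
  \<open>[i - q, q]\<close> with \<open>q < m\<close> and \<open>i - m < 2 q \<le> i\<close>; counting these \<open>q\<close> gives
  \<open>H(m,2)\<^sub>i = min m (\<lfloor>i/2\<rfloor> + 1) - \<lfloor>(i + 2 - m)/2\<rfloor>\<^sub>\<star>\<close> (lemma \<open>hilbert2_eq\<close>), which is the claimed
  formula, since \<open>min m n = n - max 0 (n - m)\<close>.

  These classes are linearly independent, because the rewriting is triangular: take
  \<open>f = a e\<^sub>1(m) + b e\<^sub>2(m)\<close> with \<open>a\<close> symmetric. For \<open>q < m\<close> the coefficient of
  \<open>x\<^sub>1\<^sup>i\<^sup>-\<^sup>q x\<^sub>2\<^sup>q\<close> in \<open>f\<close> is just the coefficient of \<open>x\<^sub>1\<^sup>i\<^sup>-\<^sup>q\<^sup>-\<^sup>m x\<^sub>2\<^sup>q\<close> in \<open>a\<close>. If it vanishes for all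
  \<open>q\<close> with \<open>m + 2 q \<le> i\<close>, then half of the coefficients of \<open>a\<close> in degree \<open>i - m\<close> are zero, by
  symmetry all of them are, and so the coefficients of \<open>f\<close> for all other \<open>q < m\<close> vanish too
  (\<open>bicoeff_below_leading\<close>). A combination of the proposed basis forms satisfies this hypothesis,
  so it can lie in the ideal only if it is trivial.

  The three statements about the shape of the Hilbert function are arithmetic with this
  formula. For odd \<open>m > 1\<close> the values at \<open>m - 1\<close>, \<open>m\<close>, \<open>m + 1\<close> form a valley, which rules out
  unimodality.
\<close>

(* The degree-one generators are e1 1 and e2 1; the numeral 1 has to survive simplification. *)
declare One_nat_def [simp del]

section \<open>Coefficients of symmetric polynomials\<close>

definition bicoeff :: "rat poly poly \<Rightarrow> nat \<Rightarrow> nat \<Rightarrow> rat" where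
  "bicoeff f p q = poly.coeff (poly.coeff f q) p"

definition symmon :: "nat \<Rightarrow> nat \<Rightarrow> rat poly poly" where
  "symmon p q = x1 ^ p * x2 ^ q + x1 ^ q * x2 ^ p"

text \<open>
  Symmetry is stated through coefficients instead of the substitution exchanging the variables,
  since coefficients are all that the independence argument looks at.
\<close>

definition swap_invariant :: "rat poly poly \<Rightarrow> bool" where
  "swap_invariant f \<longleftrightarrow> (\<forall>p q. bicoeff f p q = bicoeff f q p)"

lemma x1_power: "x1 ^ p = [:Polynomial.monom 1 p:]"
  by (induction p) (simp_all add: x1_def one_pCons Polynomial.monom_altdef)

lemma x2_power: "x2 ^ q = Polynomial.monom 1 q"
  by (simp add: x2_def Polynomial.monom_altdef)

lemma bicoeff_add [simp]: "bicoeff (f + g) p q = bicoeff f p q + bicoeff g p q"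
  by (simp add: bicoeff_def)

lemma bicoeff_minus [simp]: "bicoeff (- f) p q = - bicoeff f p q"
  by (simp add: bicoeff_def)

lemma bicoeff_sum: "bicoeff (\<Sum>j\<in>A. f j) p q = (\<Sum>j\<in>A. bicoeff (f j) p q)"
  by (simp add: bicoeff_def Polynomial.coeff_sum)

lemma bicoeff_const_poly_mult [simp]: "bicoeff (const_poly c * f) p q = c * bicoeff f p q"
  by (simp add: bicoeff_def const_poly_def)

lemma bicoeff_x1_power_mult:
  "bicoeff (x1 ^ k * f) p q = (if k \<le> p then bicoeff f (p - k) q else 0)"
  by (simp add: bicoeff_def x1_power Polynomial.coeff_monom_mult)

lemma bicoeff_x2_power_mult:
  "bicoeff (x2 ^ k * f) p q = (if k \<le> q then bicoeff f p (q - k) else 0)"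
  by (simp add: bicoeff_def x2_power Polynomial.coeff_monom_mult)

lemma bicoeff_const_poly: "bicoeff (const_poly c) p q = (if p = 0 \<and> q = 0 then c else 0)"
  by (simp add: bicoeff_def const_poly_def Polynomial.coeff_pCons split: nat.split)

lemma const_poly_1: "const_poly 1 = 1"
  by (simp add: const_poly_def one_pCons)

lemma bicoeff_monomial: "bicoeff (x1 ^ a * x2 ^ b) p q = (if p = a \<and> q = b then 1 else 0)"
  using bicoeff_x1_power_mult[of a "x2 ^ b * 1" p q]
  unfolding bicoeff_x2_power_mult
  using bicoeff_const_poly[of 1] by (auto simp: const_poly_1)

lemma bicoeff_symmon:
  "bicoeff (symmon a b) p q = (if p = a \<and> q = b then 1 else 0) + (if p = b \<and> q = a then 1 else 0)"
  by (simp add: symmon_def bicoeff_monomial)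

lemma bicoeff_mult:
  "bicoeff (f * g) p q = (\<Sum>j\<le>q. \<Sum>i\<le>p. bicoeff f i j * bicoeff g (p - i) (q - j))"
  by (simp add: bicoeff_def Polynomial.coeff_mult Polynomial.coeff_sum)

lemma swap_invariant_mult:
  assumes "swap_invariant f" and "swap_invariant g"
  shows "swap_invariant (f * g)"
  unfolding swap_invariant_def
proof (intro allI)
  fix p q
  have "bicoeff (f * g) p q = (\<Sum>i\<le>p. \<Sum>j\<le>q. bicoeff f i j * bicoeff g (p - i) (q - j))"
    unfolding bicoeff_mult by (rule sum.swap)
  also have "\<dots> = (\<Sum>i\<le>p. \<Sum>j\<le>q. bicoeff f j i * bicoeff g (q - j) (p - i))"
    using assms by (simp add: swap_invariant_def)
  also have "\<dots> = bicoeff (f * g) q p"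
    unfolding bicoeff_mult ..
  finally show "bicoeff (f * g) p q = bicoeff (f * g) q p" .
qed

lemma symmon_commute: "symmon p q = symmon q p"
  by (simp add: symmon_def)

lemma e1_mult_symmon: "e1 k * symmon p q = symmon (p + k) q + symmon p (q + k)"
  by (simp add: e1_def symmon_def power_add algebra_simps)

lemma e2_mult_symmon: "e2 k * symmon p q = symmon (p + k) (q + k)"
  by (simp add: e2_def symmon_def power_add algebra_simps)

text \<open>
  In degree \<open>i\<close>, \<open>f = a e\<^sub>1(m) + b e\<^sub>2(m)\<close> is determined below exponent \<open>m\<close> by its coefficients at the
  leading monomials \<open>x\<^sub>1\<^sup>i\<^sup>-\<^sup>q x\<^sub>2\<^sup>q\<close>, \<open>m + 2 q \<le> i\<close>: they are the coefficients of \<open>a\<close> at \<open>x\<^sub>1\<^sup>s x\<^sub>2\<^sup>q\<close> for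
  \<open>q \<le> s\<close>, \<open>s + q = i - m\<close>, and symmetry of \<open>a\<close> supplies the other half. The bound \<open>i < 3 m\<close> makes
  every such \<open>q\<close> smaller than \<open>m\<close>, so that neither \<open>e\<^sub>2(m)\<close> nor the summand \<open>x\<^sub>2\<^sup>m\<close> of \<open>e\<^sub>1(m)\<close>
  contributes.
\<close>

lemma bicoeff_below_leading:
  assumes a: "swap_invariant a"
    and i: "i < 3 * m"
    and vanish: "\<And>q. m + 2 * q \<le> i \<Longrightarrow> bicoeff (a * e1 m + b * e2 m) (i - q) q = 0"
    and q: "q < m"
  shows "bicoeff (a * e1 m + b * e2 m) (i - q) q = 0"
proof -
  have coeff_eq: "bicoeff (a * e1 m + b * e2 m) p r = (if m \<le> p then bicoeff a (p - m) r else 0)"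
    if "r < m" for p r
  proof -
    have "a * e1 m + b * e2 m = x1 ^ m * a + x2 ^ m * (a + x1 ^ m * b)"
      by (simp add: e1_def e2_def algebra_simps)
    then show ?thesis
      using that by (simp add: bicoeff_x1_power_mult bicoeff_x2_power_mult)
  qed
  have half: "bicoeff a s r = 0" if "r \<le> s" "s + r + m = i" for r s
  proof -
    have "r < m" "m + 2 * r \<le> i" "i - r = s + m"
      using that i by auto
    then show ?thesis
      using vanish[of r] coeff_eq[of r "i - r"] by simp
  qed
  then have "bicoeff a s r = 0" if "s + r + m = i" for r s
    using a that unfolding swap_invariant_def
    by (metis add.commute nat_le_linear)
  from this[of "i - q - m" q] show ?thesis
    using coeff_eq[OF q, of "i - q"] q by (cases "m \<le> i - q") auto
qed

section \<open>The ring of symmetric polynomials and its graded pieces\<close>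

lemma Sym2_simps [simp]:
  "x \<otimes>\<^bsub>Sym2\<^esub> y = x * y" "x \<oplus>\<^bsub>Sym2\<^esub> y = x + y" "\<one>\<^bsub>Sym2\<^esub> = 1" "\<zero>\<^bsub>Sym2\<^esub> = 0"
  by (simp_all add: Sym2_def ring_of_type_algebra_def)

lemma cring_Sym2: "cring Sym2"
proof -
  interpret R: cring "ring_of_type_algebra :: rat poly poly ring"
    by (rule cring_from_type_algebra)
  have sub: "range const_poly \<union> {e1 1, e2 1} \<subseteq> carrier (ring_of_type_algebra :: rat poly poly ring)"
    by (simp add: ring_of_type_algebra_def)
  show ?thesis
    unfolding Sym2_def
    using R.subcringI'[OF R.generate_ring_is_subring[OF sub]]
      R.subcring_iff[OF R.generate_ring_incl[OF sub]] by simp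
qed

interpretation Sym2: cring Sym2
  by (rule cring_Sym2)

lemma const_poly_in_Sym2 [simp, intro]: "const_poly c \<in> carrier Sym2"
  by (simp add: Sym2_def generate_ring.incl)

lemma e1_1_in_Sym2: "e1 1 \<in> carrier Sym2"
  and e2_1_in_Sym2: "e2 1 \<in> carrier Sym2"
  by (simp_all add: Sym2_def generate_ring.incl)

lemma Sym2_mult_closed [intro]: "f \<in> carrier Sym2 \<Longrightarrow> g \<in> carrier Sym2 \<Longrightarrow> f * g \<in> carrier Sym2"
  using Sym2.m_closed[of f g] by simp

lemma Sym2_add_closed [intro]: "f \<in> carrier Sym2 \<Longrightarrow> g \<in> carrier Sym2 \<Longrightarrow> f + g \<in> carrier Sym2"
  using Sym2.a_closed[of f g] by simp

lemma Sym2_power_closed [intro]: "f \<in> carrier Sym2 \<Longrightarrow> f ^ n \<in> carrier Sym2"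
  using Sym2.one_closed by (induction n) auto

lemma Sym2_sum_closed: "(\<And>j. j \<in> A \<Longrightarrow> f j \<in> carrier Sym2) \<Longrightarrow> sum f A \<in> carrier Sym2"
  using Sym2.zero_closed by (induction A rule: infinite_finite_induct) auto

lemma Sym2_swap_invariant:
  assumes "f \<in> carrier Sym2"
  shows "swap_invariant f"
proof -
  have neg: "\<ominus>\<^bsub>ring_of_type_algebra\<^esub> h = - h" for h :: "rat poly poly"
  proof -
    interpret R: cring "ring_of_type_algebra :: rat poly poly ring"
      by (rule cring_from_type_algebra)
    show ?thesis
      by (rule R.minus_equality) (simp_all add: ring_of_type_algebra_def)
  qed
  have e: "swap_invariant (e1 1)" "swap_invariant (e2 1)"
    using bicoeff_symmon[of 1 0] bicoeff_monomial[of 1 1]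
    by (auto simp: swap_invariant_def e1_def e2_def symmon_def)
  have "f \<in> generate_ring ring_of_type_algebra (range const_poly \<union> {e1 1, e2 1})"
    using assms by (simp add: Sym2_def)
  then show ?thesis
  proof induction
    case one
    have "swap_invariant (const_poly 1)"
      by (simp add: swap_invariant_def bicoeff_const_poly)
    then show ?case
      by (simp add: ring_of_type_algebra_def const_poly_1)
  next
    case (incl h)
    then show ?case
      using e by (auto simp: swap_invariant_def bicoeff_const_poly)
  next
    case (a_inv h)
    then show ?case
      by (simp add: neg swap_invariant_def)
  next
    case (eng_add h1 h2)
    then show ?case
      by (simp add: ring_of_type_algebra_def swap_invariant_def)
  next
    case (eng_mult h1 h2)
    then show ?case
      by (simp add: ring_of_type_algebra_def swap_invariant_mult)
  qed
qed

lemma finite_weighted_exponents: "finite {(a, b). a + 2 * b = (i :: nat)}"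
  by (rule finite_subset[of _ "{..i} \<times> {..i}"]) auto

lemma const_poly_add: "const_poly (c + d) = const_poly c + const_poly d"
  by (simp add: const_poly_def)

lemma const_poly_mult: "const_poly (c * d) = const_poly c * const_poly d"
  by (simp add: const_poly_def)

lemma const_poly_minus_1: "const_poly (- 1) = - 1"
  by (simp add: const_poly_def one_pCons)

lemma const_poly_0: "const_poly 0 = 0"
  by (simp add: const_poly_def)

lemma Sym2_comp_add:
  assumes "f \<in> Sym2_comp i" and "g \<in> Sym2_comp i"
  shows "f + g \<in> Sym2_comp i"
proof -
  obtain c d where
    "f = (\<Sum>(a, b)\<in>{(a, b). a + 2 * b = i}. const_poly (c a b) * e1 1 ^ a * e2 1 ^ b)"
    "g = (\<Sum>(a, b)\<in>{(a, b). a + 2 * b = i}. const_poly (d a b) * e1 1 ^ a * e2 1 ^ b)"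
    using assms unfolding Sym2_comp_def by blast
  then have "f + g = (\<Sum>(a, b)\<in>{(a, b). a + 2 * b = i}.
      const_poly (c a b + d a b) * e1 1 ^ a * e2 1 ^ b)"
    by (simp add: const_poly_add distrib_right case_prod_beta sum.distrib)
  then show ?thesis
    unfolding Sym2_comp_def by (intro CollectI exI[of _ "\<lambda>a b. c a b + d a b"]) simp
qed

lemma Sym2_comp_const_mult:
  assumes "f \<in> Sym2_comp i"
  shows "const_poly t * f \<in> Sym2_comp i"
proof -
  obtain c where
    "f = (\<Sum>(a, b)\<in>{(a, b). a + 2 * b = i}. const_poly (c a b) * e1 1 ^ a * e2 1 ^ b)"
    using assms unfolding Sym2_comp_def by blast
  then have "const_poly t * f = (\<Sum>(a, b)\<in>{(a, b). a + 2 * b = i}.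
      const_poly (t * c a b) * e1 1 ^ a * e2 1 ^ b)"
    by (simp add: const_poly_mult sum_distrib_left mult.assoc case_prod_beta)
  then show ?thesis
    unfolding Sym2_comp_def by (intro CollectI exI[of _ "\<lambda>a b. t * c a b"]) simp
qed

lemma Sym2_comp_monomial:
  assumes "a + 2 * b = i"
  shows "e1 1 ^ a * e2 1 ^ b \<in> Sym2_comp i"
proof -
  have "(\<Sum>(a', b')\<in>{(a, b). a + 2 * b = i}.
      const_poly (if a' = a \<and> b' = b then 1 else 0) * e1 1 ^ a' * e2 1 ^ b')
     = (\<Sum>p\<in>{(a, b). a + 2 * b = i}. if p = (a, b) then e1 1 ^ a * e2 1 ^ b else 0)"
    by (intro sum.cong) (auto simp: const_poly_0 const_poly_1 split: if_splits)
  also have "\<dots> = e1 1 ^ a * e2 1 ^ b"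
    using assms by (simp add: sum.delta[OF finite_weighted_exponents])
  finally show ?thesis
    unfolding Sym2_comp_def
    by (intro CollectI exI[of _ "\<lambda>a' b'. if a' = a \<and> b' = b then 1 else 0"]) simp
qed

lemma Sym2_comp_0: "0 \<in> Sym2_comp i"
  unfolding Sym2_comp_def by (intro CollectI exI[of _ "\<lambda>_ _. 0"]) (simp add: const_poly_0)

lemma Sym2_comp_sum: "(\<And>j. j \<in> A \<Longrightarrow> f j \<in> Sym2_comp i) \<Longrightarrow> sum f A \<in> Sym2_comp i"
  by (induction A rule: infinite_finite_induct) (auto simp: Sym2_comp_0 Sym2_comp_add)

lemma e1_mult_Sym2_comp:
  assumes "f \<in> Sym2_comp i"
  shows "e1 1 * f \<in> Sym2_comp (Suc i)"
proof -
  obtain c where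
    f: "f = (\<Sum>(a, b)\<in>{(a, b). a + 2 * b = i}. const_poly (c a b) * e1 1 ^ a * e2 1 ^ b)"
    using assms unfolding Sym2_comp_def by blast
  have "e1 1 * f = (\<Sum>(a, b)\<in>{(a, b). a + 2 * b = i}.
      const_poly (c a b) * (e1 1 ^ Suc a * e2 1 ^ b))"
    by (simp add: f sum_distrib_left case_prod_beta algebra_simps)
  also have "\<dots> \<in> Sym2_comp (Suc i)"
    by (intro Sym2_comp_sum)
      (force simp del: power_Suc intro!: Sym2_comp_const_mult Sym2_comp_monomial)
  finally show ?thesis .
qed

text \<open>
  Induction on the difference \<open>k\<close> of the exponents: the identity
  \<open>[k + 2 + q, q] = e\<^sub>1 [k + 1 + q, q] - [k + (q + 1), q + 1]\<close> lowers it. This is Newton's recursion for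
  power sums, multiplied by a power of \<open>e\<^sub>2\<close>.
\<close>

lemma symmon_in_Sym2_comp: "symmon (k + q) q \<in> Sym2_comp (k + 2 * q)"
proof (induction k arbitrary: q rule: less_induct)
  case (less k)
  consider "k = 0" | "k = 1" | j where "k = Suc (Suc j)"
    by (metis One_nat_def not0_implies_Suc)
  then show ?case
  proof cases
    case 1
    have "symmon q q = const_poly 2 * (e1 1 ^ 0 * e2 1 ^ q)"
      by (simp add: symmon_def e2_def power_mult_distrib const_poly_def numeral_poly)
    then show ?thesis
      using 1 Sym2_comp_const_mult[OF Sym2_comp_monomial[of 0 q "2 * q"]] by simp
  next
    case 2
    have "symmon (1 + q) q = e1 1 ^ 1 * e2 1 ^ q"
      by (simp add: symmon_def e1_def e2_def power_mult_distrib power_add algebra_simps)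
    then show ?thesis
      using 2 Sym2_comp_monomial[of 1 q "1 + 2 * q"] by simp
  next
    case 3
    have "symmon (k + q) q = e1 1 * symmon (Suc j + q) q + const_poly (- 1) * symmon (j + Suc q) (Suc q)"
      using e1_mult_symmon[of 1 "Suc j + q" q] 3 Suc_eq_plus1[symmetric]
      by (simp add: const_poly_minus_1)
    then show ?thesis
      using 3 e1_mult_Sym2_comp[OF less.IH[of "Suc j" q]]
        Sym2_comp_const_mult[OF less.IH[of j "Suc q"]]
      by (simp add: Sym2_comp_add)
  qed
qed

lemma Sym2_comp_subset_Sym2: "Sym2_comp i \<subseteq> carrier Sym2"
  unfolding Sym2_comp_def
  by (auto intro!: Sym2_sum_closed Sym2_mult_closed Sym2_power_closed e1_1_in_Sym2 e2_1_in_Sym2)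

lemma symmon_in_Sym2 [simp]: "symmon p q \<in> carrier Sym2"
proof (cases "q \<le> p")
  case True
  then show ?thesis
    using symmon_in_Sym2_comp[of "p - q" q] Sym2_comp_subset_Sym2 by auto
next
  case False
  then show ?thesis
    using symmon_in_Sym2_comp[of "q - p" p] Sym2_comp_subset_Sym2 by (auto simp: symmon_commute)
qed

lemma e1_in_Sym2 [simp]: "e1 m \<in> carrier Sym2"
  using symmon_in_Sym2[of m 0] by (simp add: symmon_def e1_def)

lemma e2_in_Sym2 [simp]: "e2 m \<in> carrier Sym2"
  using Sym2_power_closed[OF e2_1_in_Sym2, of m] by (simp add: e2_def power_mult_distrib)

text \<open>
  A linear subspace \<open>W\<close> containing all \<open>[p, q]\<close> of degree \<open>i\<close> contains the whole graded piece, because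
  \<open>e\<^sub>1\<^sup>a e\<^sub>2\<^sup>b\<close> is half of \<open>e\<^sub>1\<^sup>a [b, b]\<close>, and each factor \<open>e\<^sub>1\<close> turns \<open>[p, q]\<close> into \<open>[p + 1, q] + [p, q + 1]\<close>.
\<close>

lemma Sym2_comp_subset_if_symmon:
  assumes symmon: "\<And>p q. p + q = i \<Longrightarrow> symmon p q \<in> W"
    and zero: "0 \<in> W"
    and add: "\<And>f g. f \<in> W \<Longrightarrow> g \<in> W \<Longrightarrow> f + g \<in> W"
    and scale: "\<And>c f. f \<in> W \<Longrightarrow> const_poly c * f \<in> W"
  shows "Sym2_comp i \<subseteq> W"
proof
  fix f assume "f \<in> Sym2_comp i"
  then obtain c where
    f: "f = (\<Sum>(a, b)\<in>{(a, b). a + 2 * b = i}. const_poly (c a b) * e1 1 ^ a * e2 1 ^ b)"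
    unfolding Sym2_comp_def by blast
  have expand: "e1 1 ^ a * symmon p q \<in> W" if "a + p + q = i" for a p q
    using that
  proof (induction a arbitrary: p q)
    case 0
    then show ?case by (simp add: symmon)
  next
    case (Suc a)
    have "e1 1 ^ Suc a * symmon p q = e1 1 ^ a * (e1 1 * symmon p q)"
      by (simp add: mult_ac)
    also have "\<dots> = e1 1 ^ a * symmon (p + 1) q + e1 1 ^ a * symmon p (q + 1)"
      by (simp add: e1_mult_symmon distrib_left)
    finally show ?case
      using Suc.IH[of "p + 1" q] Suc.IH[of p "q + 1"] Suc.prems add by simp
  qed
  have term_in: "const_poly t * e1 1 ^ a * e2 1 ^ b \<in> W" if "a + 2 * b = i" for t a b
  proof -
    have "const_poly t = const_poly (t / 2) * 2"
      by (simp add: const_poly_def numeral_poly)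
    moreover have "symmon b b = 2 * e2 1 ^ b"
      by (simp add: symmon_def e2_def power_mult_distrib)
    ultimately have eq: "const_poly t * e1 1 ^ a * e2 1 ^ b = const_poly (t / 2) * (e1 1 ^ a * symmon b b)"
      by (simp only: mult_ac)
    show ?thesis
      unfolding eq using that by (intro scale expand) simp
  qed
  have "(\<Sum>(a, b)\<in>B. const_poly (c a b) * e1 1 ^ a * e2 1 ^ b) \<in> W"
    if "B \<subseteq> {(a, b). a + 2 * b = i}" for B
    using that
    by (induction B rule: infinite_finite_induct) (auto simp: zero intro!: add term_in)
  then show "f \<in> W"
    unfolding f by blast
qed

section \<open>The quotient and its graded pieces\<close>

abbreviation residue_class :: "nat \<Rightarrow> rat poly poly \<Rightarrow> rat poly poly set" where
  "residue_class m \<equiv> a_r_coset Sym2 (power_ideal m)"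

lemma power_ideal_ideal: "ideal (power_ideal m) Sym2"
  unfolding power_ideal_def by (rule Sym2.genideal_ideal) simp

lemma in_power_ideal:
  assumes "f \<in> carrier Sym2"
  shows "e1 m * f \<in> power_ideal m" and "e2 m * f \<in> power_ideal m"
proof -
  have "{e1 m, e2 m} \<subseteq> power_ideal m"
    unfolding power_ideal_def by (rule Sym2.genideal_self) simp
  then show "e1 m * f \<in> power_ideal m" and "e2 m * f \<in> power_ideal m"
    using ideal.I_r_closed[OF power_ideal_ideal _ assms] by auto
qed

lemma power_ideal_elim:
  assumes "f \<in> power_ideal m"
  obtains a b where "a \<in> carrier Sym2" "f = a * e1 m + b * e2 m"
proof -
  let ?J = "{a * e1 m + b * e2 m | a b. a \<in> carrier Sym2 \<and> b \<in> carrier Sym2}"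
  have neg: "- a \<in> carrier Sym2" if "a \<in> carrier Sym2" for a
    using Sym2_mult_closed[OF const_poly_in_Sym2[of "- 1"] that] by (simp add: const_poly_minus_1)
  have "ideal ?J Sym2"
  proof (rule idealI)
    show "subgroup ?J (add_monoid Sym2)"
    proof (rule Sym2.add.subgroupI)
      show "?J \<subseteq> carrier Sym2"
        by (auto intro!: Sym2_add_closed Sym2_mult_closed)
      show "?J \<noteq> {}" by (auto intro: Sym2.zero_closed)
    next
      fix x assume "x \<in> ?J"
      then obtain a b where x: "a \<in> carrier Sym2" "b \<in> carrier Sym2" "x = a * e1 m + b * e2 m"
        by blast
      have "\<ominus>\<^bsub>Sym2\<^esub> x = - x"
        using neg[of x] Sym2_add_closed[OF Sym2_mult_closed Sym2_mult_closed, of a "e1 m" b "e2 m"] x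
        by (intro Sym2.minus_equality) auto
      also have "- x = (- a) * e1 m + (- b) * e2 m"
        by (simp add: x)
      finally show "\<ominus>\<^bsub>Sym2\<^esub> x \<in> ?J"
        using x neg by blast
    next
      fix x y assume "x \<in> ?J" "y \<in> ?J"
      then obtain a b c d where x: "a \<in> carrier Sym2" "b \<in> carrier Sym2" "x = a * e1 m + b * e2 m"
        and y: "c \<in> carrier Sym2" "d \<in> carrier Sym2" "y = c * e1 m + d * e2 m"
        by blast
      have "x \<oplus>\<^bsub>Sym2\<^esub> y = (a + c) * e1 m + (b + d) * e2 m"
        by (simp add: x y algebra_simps)
      then show "x \<oplus>\<^bsub>Sym2\<^esub> y \<in> ?J"
        using x y by blast
    qed
  next
    fix x y assume "x \<in> ?J" and y: "y \<in> carrier Sym2"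
    then obtain a b where x: "a \<in> carrier Sym2" "b \<in> carrier Sym2" "x = a * e1 m + b * e2 m"
      by blast
    have "y * x = (y * a) * e1 m + (y * b) * e2 m"
      by (simp add: x algebra_simps)
    then have "y * x \<in> ?J"
      using x y by blast
    then show "y \<otimes>\<^bsub>Sym2\<^esub> x \<in> ?J" "x \<otimes>\<^bsub>Sym2\<^esub> y \<in> ?J"
      by (simp_all add: mult.commute)
  qed (rule Sym2.ring_axioms)
  moreover have "{e1 m, e2 m} \<subseteq> ?J"
  proof -
    have "e1 m = 1 * e1 m + 0 * e2 m" "e2 m = 0 * e1 m + 1 * e2 m" by simp_all
    then show ?thesis
      using Sym2.zero_closed Sym2.one_closed by (simp, metis)
  qed
  ultimately have "f \<in> ?J"
    using assms Sym2.genideal_minimal unfolding power_ideal_def by blast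
  then show thesis
    using that by blast
qed

text \<open>
  This is how membership in the ideal is refuted: for nontrivial combinations of basis forms and,
  with \<open>i = q = 0\<close>, for the constant 1.
\<close>

lemma coeff_zero_if_in_power_ideal:
  assumes "f \<in> power_ideal m" and "i < 3 * m" and "q < m"
    and "\<And>q. m + 2 * q \<le> i \<Longrightarrow> bicoeff f (i - q) q = 0"
  shows "bicoeff f (i - q) q = 0"
  using assms power_ideal_elim[OF assms(1)] bicoeff_below_leading Sym2_swap_invariant by metis

interpretation A2: ring "A2 m" for m
  unfolding A2_def by (rule ideal.quotient_is_ring[OF power_ideal_ideal])

lemma residue_class_hom: "residue_class m \<in> ring_hom Sym2 (A2 m)"
  unfolding A2_def by (rule ideal.rcos_ring_hom[OF power_ideal_ideal])

lemmas residue_class_closed = ring_hom_memE(1)[OF residue_class_hom]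
  and residue_class_mult = ring_hom_memE(2)[OF residue_class_hom, unfolded Sym2_simps]
  and residue_class_add = ring_hom_memE(3)[OF residue_class_hom, unfolded Sym2_simps]
  and residue_class_one = ring_hom_memE(4)[OF residue_class_hom, unfolded Sym2_simps]

lemma zero_A2: "\<zero>\<^bsub>A2 m\<^esub> = power_ideal m"
  by (simp add: A2_def FactRing_def)

lemma residue_class_eq_zero_iff:
  assumes "f \<in> carrier Sym2"
  shows "residue_class m f = \<zero>\<^bsub>A2 m\<^esub> \<longleftrightarrow> f \<in> power_ideal m"
proof -
  interpret ideal "power_ideal m" Sym2
    by (rule power_ideal_ideal)
  show ?thesis
    using assms a_rcos_self a_rcos_const unfolding zero_A2 by blast
qed

lemma residue_class_zero: "residue_class m 0 = \<zero>\<^bsub>A2 m\<^esub>"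
  using residue_class_eq_zero_iff[of 0 m] Sym2.zero_closed
    additive_subgroup.zero_closed[OF ideal.axioms(1)[OF power_ideal_ideal], of m] by simp

text \<open>
  The scalars are the image of the field of rationals under a ring homomorphism, hence a field as
  soon as the quotient is not the zero ring.
\<close>

lemma subfield_A2_scalars:
  assumes "m \<ge> 1"
  shows "subfield (A2_scalars m) (A2 m)"
proof -
  let ?Q = "ring_of_type_algebra :: rat ring"
  interpret Q: field ?Q
    by (rule field_from_type_algebra)
  have "const_poly \<in> ring_hom ?Q Sym2"
    by (rule ring_hom_memI)
      (simp_all add: ring_of_type_algebra_def const_poly_add const_poly_mult const_poly_1)
  then have "residue_class m \<circ> const_poly \<in> ring_hom ?Q (A2 m)"
    using residue_class_hom by (rule ring_hom_trans)
  then have hom: "ring_hom_ring ?Q (A2 m) (residue_class m \<circ> const_poly)"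
    by (intro ring_hom_ringI2 Q.ring_axioms A2.ring_axioms)
  have "1 \<notin> power_ideal m"
    using coeff_zero_if_in_power_ideal[of 1 m 0 0] bicoeff_const_poly[of 1 0 0] assms
    by (auto simp: const_poly_1)
  then have "\<one>\<^bsub>A2 m\<^esub> \<noteq> \<zero>\<^bsub>A2 m\<^esub>"
    using residue_class_eq_zero_iff[of 1 m] residue_class_one[of m] Sym2.one_closed by auto
  from ring_hom_ring.img_is_subfield(2)[OF hom Q.carrier_is_subfield this]
  show ?thesis
    by (simp add: A2_scalars_def ring_of_type_algebra_def image_comp)
qed

text \<open>
  Linear combinations in the quotient lift to polynomials. The minimum occurs because \<open>combine\<close>
  truncates the longer of its two lists.
\<close>

lemma combine_residue_classes:
  assumes "set gs \<subseteq> carrier Sym2"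
  shows "ring.combine (A2 m) (map (\<lambda>c. residue_class m (const_poly c)) cs) (map (residue_class m) gs)
    = residue_class m (\<Sum>j < min (length cs) (length gs). const_poly (cs ! j) * gs ! j)"
  using assms
proof (induction cs arbitrary: gs)
  case Nil
  then show ?case
    using residue_class_zero[of m] by simp
next
  case (Cons c cs)
  show ?case
  proof (cases gs)
    case Nil
    then show ?thesis
      using residue_class_zero[of m] by simp
  next
    case (Cons g gs')
    let ?s = "\<Sum>j < min (length cs) (length gs'). const_poly (cs ! j) * gs' ! j"
    have in_Sym2: "const_poly c * g \<in> carrier Sym2" "?s \<in> carrier Sym2"
      using Cons.prems Cons by (auto intro!: Sym2_sum_closed Sym2_mult_closed dest: nth_mem)
    have g: "g \<in> carrier Sym2" "set gs' \<subseteq> carrier Sym2"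
      using Cons.prems Cons by auto
    have "ring.combine (A2 m) (map (\<lambda>c. residue_class m (const_poly c)) (c # cs)) (map (residue_class m) gs)
      = residue_class m (const_poly c) \<otimes>\<^bsub>A2 m\<^esub> residue_class m g \<oplus>\<^bsub>A2 m\<^esub> residue_class m ?s"
      using Cons.IH[OF g(2)] by (simp add: Cons)
    also have "\<dots> = residue_class m (const_poly c * g + ?s)"
      using residue_class_mult[OF const_poly_in_Sym2 g(1), of m c] residue_class_add[OF in_Sym2, of m] by simp
    also have "const_poly c * g + ?s
      = (\<Sum>j < min (length (c # cs)) (length gs). const_poly ((c # cs) ! j) * gs ! j)"
      by (simp add: Cons sum.lessThan_Suc_shift del: sum.lessThan_Suc)
    finally show ?thesis .
  qed
qed

text \<open>
  The bounds on \<open>q\<close> encode \<open>i < m + 2 q\<close>, \<open>q < m\<close> and \<open>2 q \<le> i\<close>. Truncated subtraction makes the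
  lower bound 0 when \<open>i < m\<close>, where the ideal has no nonzero element of degree \<open>i\<close>.
\<close>

definition basis_forms :: "nat \<Rightarrow> nat \<Rightarrow> rat poly poly list" where
  "basis_forms m i = map (\<lambda>q. symmon (i - q) q) [(i + 2 - m) div 2 ..< min m (i div 2 + 1)]"

lemma basis_forms_in_Sym2: "set (basis_forms m i) \<subseteq> carrier Sym2"
  by (auto simp: basis_forms_def)

lemma nth_basis_forms:
  assumes "j < length (basis_forms m i)"
  defines "q \<equiv> (i + 2 - m) div 2 + j"
  shows "basis_forms m i ! j = symmon (i - q) q" and "q < m" and "2 * q \<le> i"
proof -
  have "q < min m (i div 2 + 1)"
    using assms by (simp add: basis_forms_def less_diff_conv add.commute)
  moreover from this have "[(i + 2 - m) div 2 ..< min m (i div 2 + 1)] ! j = q"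
    unfolding q_def by (rule nth_upt)
  ultimately show "basis_forms m i ! j = symmon (i - q) q" and "q < m" and "2 * q \<le> i"
    using assms by (auto simp: basis_forms_def simp del: upt_conv_Cons)
qed

text \<open>
  A vanishing combination lifts to some \<open>f\<close> in the ideal whose coefficients below the range of \<open>q\<close> are
  zero, so the coefficients within the range vanish as well. Those are the scalars of the
  combination, up to a factor 2 for \<open>[q, q]\<close>.
\<close>

lemma basis_forms_independent:
  assumes m: "m \<ge> 1" and i: "i < 3 * m"
  shows "ring.independent (A2 m) (A2_scalars m) (map (residue_class m) (basis_forms m i))"
proof (rule A2.trivial_combine_imp_independent[OF subfield_A2_scalars[OF m]])
  show "set (map (residue_class m) (basis_forms m i)) \<subseteq> carrier (A2 m)"
    using basis_forms_in_Sym2[of m i] residue_class_closed by auto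
next
  define L n where "L = (i + 2 - m) div 2" and "n = length (basis_forms m i)"
  fix Ks
  assume "set Ks \<subseteq> A2_scalars m"
    and combine: "ring.combine (A2 m) Ks (map (residue_class m) (basis_forms m i)) = \<zero>\<^bsub>A2 m\<^esub>"
  then obtain cs where Ks: "Ks = map (\<lambda>c. residue_class m (const_poly c)) cs"
    unfolding A2_scalars_def by (metis (no_types, lifting) ex_map_conv image_iff subsetD)
  define N where "N = min (length cs) n"
  define f where "f = (\<Sum>j<N. const_poly (cs ! j) * basis_forms m i ! j)"
  have basis_nth: "basis_forms m i ! j = symmon (i - (L + j)) (L + j)"
    "L + j < m" "2 * (L + j) \<le> i" if "j < N" for j
    using that nth_basis_forms[of j m i] by (auto simp: N_def n_def L_def)
  have bicoeff_symmon_in_degree: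
      "bicoeff (symmon (i - r) r) (i - q) q = (if r = q then if i = 2 * q then 2 else 1 else 0)"
    if "2 * r \<le> i" "2 * q \<le> i" for r q
  proof -
    have "i - q = i - r \<and> q = r \<longleftrightarrow> r = q" and "i - q = r \<and> q = i - r \<longleftrightarrow> r = q \<and> i = 2 * q"
      using that by auto
    then show ?thesis
      unfolding bicoeff_symmon by simp
  qed
  have bicoeff_f: "bicoeff f (i - q) q =
      (\<Sum>j<N. if j = q - L then cs ! j * (if i = 2 * q then 2 else 1) else 0)"
    if "L \<le> q" "2 * q \<le> i" for q
    unfolding f_def bicoeff_sum
    using that basis_nth by (intro sum.cong) (auto simp: bicoeff_symmon_in_degree)
  have bicoeff_f_below: "bicoeff f (i - q) q = 0" if "q < L" "2 * q \<le> i" for q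
    unfolding f_def bicoeff_sum
  proof (rule sum.neutral, safe)
    fix j assume "j < N"
    from basis_nth[OF this] show "bicoeff (const_poly (cs ! j) * basis_forms m i ! j) (i - q) q = 0"
      using that by (simp add: bicoeff_symmon_in_degree)
  qed
  have "f \<in> carrier Sym2"
    unfolding f_def using basis_nth by (auto intro!: Sym2_sum_closed Sym2_mult_closed)
  moreover have "residue_class m f = \<zero>\<^bsub>A2 m\<^esub>"
    using combine combine_residue_classes[OF basis_forms_in_Sym2]
    by (simp add: Ks f_def N_def n_def)
  ultimately have f: "f \<in> power_ideal m"
    by (simp add: residue_class_eq_zero_iff)
  have "cs ! j = 0" if j: "j < N" for j
  proof -
    have "bicoeff f (i - (L + j)) (L + j) = 0"
    proof (rule coeff_zero_if_in_power_ideal[OF f i])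
      show "L + j < m" using basis_nth[OF j] by simp
      fix q assume "m + 2 * q \<le> i"
      then show "bicoeff f (i - q) q = 0"
        by (intro bicoeff_f_below) (auto simp: L_def)
    qed
    then show ?thesis
      using bicoeff_f[of "L + j"] basis_nth[OF j] j by (simp add: split: if_splits)
  qed
  then have "set (take n cs) \<subseteq> {0}"
    by (auto simp: in_set_conv_nth N_def)
  moreover have "residue_class m (const_poly 0) = \<zero>\<^bsub>A2 m\<^esub>"
    using residue_class_zero[of m] by (simp add: const_poly_0)
  ultimately show "set (take (length (map (residue_class m) (basis_forms m i))) Ks) \<subseteq> {\<zero>\<^bsub>A2 m\<^esub>}"
    by (auto simp: Ks n_def take_map)
qed

text \<open>
  The symmetric polynomials whose class lies in the span form a subspace \<open>W\<close>, so it is enough to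
  reduce every \<open>[p, q]\<close> of degree \<open>i\<close> by the two rewriting rules.
\<close>

lemma Span_basis_forms:
  assumes m: "m \<ge> 1" and i: "i < 3 * m"
  shows "ring.Span (A2 m) (A2_scalars m) (map (residue_class m) (basis_forms m i)) = A2_comp m i"
    (is "?Span = _")
proof (intro equalityI subsetI)
  note K = subfield_A2_scalars[OF m]
  have carr: "set (map (residue_class m) (basis_forms m i)) \<subseteq> carrier (A2 m)"
    using basis_forms_in_Sym2[of m i] residue_class_closed by auto
  {
    fix x assume "x \<in> ?Span"
    then obtain Ks where Ks: "set Ks \<subseteq> A2_scalars m"
      and x: "x = ring.combine (A2 m) Ks (map (residue_class m) (basis_forms m i))"
      using A2.Span_mem_iff_length_version[OF K carr] by blast
    then obtain cs where "Ks = map (\<lambda>c. residue_class m (const_poly c)) cs"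
      unfolding A2_scalars_def by (metis (no_types, lifting) ex_map_conv image_iff subsetD)
    then have "x = residue_class m (\<Sum>j < min (length cs) (length (basis_forms m i)).
        const_poly (cs ! j) * basis_forms m i ! j)"
      using x combine_residue_classes[OF basis_forms_in_Sym2] by simp
    moreover have "symmon (i - q) q \<in> Sym2_comp i" if "2 * q \<le> i" for q
      using symmon_in_Sym2_comp[of "i - 2 * q" q] that by simp
    then have "basis_forms m i ! j \<in> Sym2_comp i" if "j < length (basis_forms m i)" for j
      using nth_basis_forms[OF that] by simp
    ultimately show "x \<in> A2_comp m i"
      unfolding A2_comp_def by (auto intro!: imageI Sym2_comp_sum Sym2_comp_const_mult)
  }
  note Span = A2.Span_subgroup_props[OF K carr]
  let ?W = "{f \<in> carrier Sym2. residue_class m f \<in> ?Span}"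
  have ideal_W: "f \<in> ?W" if "f \<in> power_ideal m" for f
  proof -
    have f: "f \<in> carrier Sym2"
      using that ideal.Icarr[OF power_ideal_ideal] by blast
    show ?thesis
      using Span(2) f that residue_class_eq_zero_iff[OF f, of m] by (simp del: A2.Span.simps)
  qed
  have add_W: "f + g \<in> ?W" if "f \<in> ?W" "g \<in> ?W" for f g
    using that Span(3) residue_class_add[of f g m] by auto
  have scale_W: "const_poly c * f \<in> ?W" if "f \<in> ?W" for c f
    using that A2.Span_smult_closed[OF K carr, of "residue_class m (const_poly c)"]
      residue_class_mult[of "const_poly c" f m]
    by (auto simp: A2_scalars_def)
  have basis_W: "symmon p q \<in> ?W" if "p + q = i" "i < m + 2 * q" "q < m" "q \<le> p" for p q
  proof -
    have "symmon p q \<in> set (basis_forms m i)"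
      using that unfolding basis_forms_def
      by (auto intro!: image_eqI[of _ _ q])
    then show ?thesis
      using A2.Span_base_incl[OF K carr] by auto
  qed
  have high_W: "symmon p q \<in> ?W" if "m \<le> p" "m \<le> q" for p q
  proof -
    have "symmon p q = e2 m * symmon (p - m) (q - m)"
      using that by (simp add: e2_mult_symmon)
    then show ?thesis
      using ideal_W in_power_ideal(2) by simp
  qed
  have leading_W: "symmon (p + m) q \<in> ?W" if "p + q + m = i" "q \<le> p" for p q
  proof -
    have ideal: "symmon (p + m) q + symmon p (q + m) \<in> ?W"
      using ideal_W in_power_ideal(1)[OF symmon_in_Sym2, of m p q]
      by (simp add: e1_mult_symmon)
    \<comment> \<open>The partner \<open>[p, q + m]\<close> vanishes, is itself a basis form, or coincides with \<open>[p + m, q]\<close>.\<close>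
    consider "m \<le> p" | "p < m" "q < p" | "p = q"
      using \<open>q \<le> p\<close> by linarith
    then show ?thesis
    proof cases
      case 3
      \<comment> \<open>\<open>[p + m, p]\<close> equals its own negative modulo the ideal, so it is zero there.\<close>
      have "symmon (p + m) q = const_poly (1 / 2) * (symmon (p + m) q + symmon p (q + m))"
      proof -
        have half: "const_poly (1 / 2) * 2 = 1"
          by (simp add: const_poly_def numeral_poly one_pCons)
        have "symmon (p + m) q + symmon p (q + m) = 2 * symmon (p + m) q"
          using symmon_commute[of p "p + m"] 3 by simp
        then show ?thesis
          by (simp only: half mult_1_left mult.assoc[symmetric])
      qed
      then show ?thesis
        using scale_W[OF ideal, of "1 / 2"] by (simp only:)
    next
      case 1
      then have "symmon p (q + m) \<in> ?W" by (intro high_W) auto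
      from add_W[OF ideal scale_W[OF this, of "- 1"]] show ?thesis
        by (simp add: const_poly_minus_1)
    next
      case 2
      then have "symmon (q + m) p \<in> ?W" using that i by (intro basis_W) auto
      from add_W[OF ideal scale_W[OF this, of "- 1"]] show ?thesis
        by (simp add: const_poly_minus_1 symmon_commute)
    qed
  qed
  have ordered_W: "symmon p q \<in> ?W" if pq: "p + q = i" "q \<le> p" for p q
  proof -
    consider "m \<le> q" | "q < m" "i < m + 2 * q" | "m + 2 * q \<le> i"
      by linarith
    then show ?thesis
    proof cases
      case 1
      then show ?thesis using pq by (intro high_W) auto
    next
      case 2
      then show ?thesis using pq by (intro basis_W) auto
    next
      case 3
      then show ?thesis using leading_W[of "p - m" q] pq by auto
    qed
  qed
  have "Sym2_comp i \<subseteq> ?W"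
  proof (rule Sym2_comp_subset_if_symmon)
    fix p q assume "p + q = i"
    then show "symmon p q \<in> ?W"
      using ordered_W[of p q] ordered_W[of q p]
      by (cases "q \<le> p") (simp_all add: symmon_commute add.commute)
  next
    show "0 \<in> ?W"
      using Span(2) Sym2.zero_closed by (simp add: residue_class_zero)
  qed (use add_W scale_W in blast)+
  then show "x \<in> ?Span" if "x \<in> A2_comp m i" for x
    using that unfolding A2_comp_def by blast
qed

lemma hilbert2_eq:
  assumes "m \<ge> 1" and "i < 3 * m"
  shows "hilbert2 m i = min m (i div 2 + 1) - (i + 2 - m) div 2"
proof -
  have "ring.dimension (A2 m) (length (basis_forms m i)) (A2_scalars m) (A2_comp m i)"
    using A2.dimension_independent[OF basis_forms_independent[OF assms]]
    unfolding Span_basis_forms[OF assms] by simp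
  from A2.dimI[OF subfield_A2_scalars[OF assms(1)] this]
  show ?thesis
    by (simp add: hilbert2_def basis_forms_def over_def)
qed

section \<open>The shape of the Hilbert function\<close>

lemma floor_half_nat: "\<lfloor>real n / 2\<rfloor> = int (n div 2)"
  using floor_divide_of_nat_eq[of n 2] by simp

text \<open>
  The truncation at 0 in \<open>floor_star\<close> is exactly that of subtraction of natural numbers.
\<close>

lemma floor_star_half_diff: "floor_star ((real n - real k) / 2) = int ((n - k) div 2)"
proof (cases "k \<le> n")
  case True
  then show ?thesis
    by (simp add: floor_star_def floor_half_nat flip: of_nat_diff)
next
  case False
  then have "\<lfloor>(real n - real k) / 2\<rfloor> \<le> 0"
    by simp
  then show ?thesis
    using False by (simp add: floor_star_def)
qed

lemma length_doubled [simp]: "length (doubled xs) = 2 * length xs"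
  by (induction xs) (simp_all add: doubled_def)

lemma doubled_Cons: "doubled (x # xs) = x # x # doubled xs"
  by (simp add: doubled_def)

lemma nth_doubled: "j < 2 * length xs \<Longrightarrow> doubled xs ! j = xs ! (j div 2)"
proof (induction xs arbitrary: j)
  case (Cons x xs)
  consider "j = 0" | "j = Suc 0" | k where "j = Suc (Suc k)"
    by (metis not0_implies_Suc)
  then show ?case
    using Cons by cases (auto simp: doubled_Cons)
qed simp

lemma unimodal_iff:
  "unimodal xs \<longleftrightarrow> (\<exists>k. (\<forall>i j. i \<le> j \<longrightarrow> j \<le> k \<longrightarrow> j < length xs \<longrightarrow> xs ! i \<le> xs ! j)
    \<and> (\<forall>i j. k \<le> i \<longrightarrow> i \<le> j \<longrightarrow> j < length xs \<longrightarrow> xs ! j \<le> xs ! i))"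
proof -
  have 1: "sorted (take (Suc k) xs) \<longleftrightarrow> (\<forall>i j. i \<le> j \<longrightarrow> j \<le> k \<longrightarrow> j < length xs \<longrightarrow> xs ! i \<le> xs ! j)"
    for k
    by (auto simp: sorted_iff_nth_mono)
  have 2: "sorted_wrt (\<ge>) (drop k xs) \<longleftrightarrow>
      (\<forall>i j. k \<le> i \<longrightarrow> i \<le> j \<longrightarrow> j < length xs \<longrightarrow> xs ! j \<le> xs ! i)" for k
  proof
    assume sorted: "sorted_wrt (\<ge>) (drop k xs)"
    show "\<forall>i j. k \<le> i \<longrightarrow> i \<le> j \<longrightarrow> j < length xs \<longrightarrow> xs ! j \<le> xs ! i"
    proof (intro allI impI)
      fix i j assume "k \<le> i" "i \<le> j" "j < length xs"
      then show "xs ! j \<le> xs ! i"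
        using sorted_wrt_nth_less[OF sorted, of "i - k" "j - k"] by (cases "i = j") auto
    qed
  qed (auto simp: sorted_wrt_iff_nth_less)
  show ?thesis
    unfolding unimodal_def 1 2 ..
qed

theorem theorem1:
  fixes m d :: nat
  assumes "m \<ge> 1" and "d = 3 * (m - 1)"
  shows "(\<forall>i\<le>d. int (hilbert2 m i) =
            \<lfloor>(real i + 2) / 2\<rfloor> - floor_star ((real i + 2 - real m) / 2)
              - floor_star ((real i + 2 - 2 * real m) / 2))
       \<and> (\<forall>m'. m = 2 * m' \<longrightarrow>
            map (hilbert2 m) [0..<d + 1] =
              doubled [1..<m'] @ replicate (m + 2) m' @ doubled (rev [1..<m']))
       \<and> (\<forall>m'. m = 2 * m' - 1 \<longrightarrow>
            map (hilbert2 m) [0..<d + 1] =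
              doubled [1..<m'] @ map (\<lambda>j. if even j then m' else m' - 1) [0..<m]
                @ doubled (rev [1..<m']))
       \<and> (m \<noteq> 1 \<longrightarrow> (unimodal (map (hilbert2 m) [0..<d + 1]) \<longleftrightarrow> even m))"
proof (intro conjI allI impI)
  have H: "hilbert2 m i = min m (i div 2 + 1) - (i + 2 - m) div 2" if "i \<le> d" for i
    using that assms by (intro hilbert2_eq) auto
  let ?h = "map (hilbert2 m) [0..<d + 1]"
  have nth_h: "?h ! i = min m (i div 2 + 1) - (i + 2 - m) div 2" if "i \<le> d" for i
    using that H by (simp del: upt_Suc)
  {
    fix i assume i: "i \<le> d"
    have "\<lfloor>(real i + 2) / 2\<rfloor> = int ((i + 2) div 2)"
      using floor_half_nat[of "i + 2"] by (simp add: add.commute)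
    moreover have "floor_star ((real i + 2 - real m) / 2) = int ((i + 2 - m) div 2)"
      using floor_star_half_diff[of "i + 2" m] by (simp add: add.commute)
    moreover have "floor_star ((real i + 2 - 2 * real m) / 2) = int ((i + 2 - 2 * m) div 2)"
      using floor_star_half_diff[of "i + 2" "2 * m"] by (simp add: add.commute)
    moreover have "int (hilbert2 m i)
        = int ((i + 2) div 2) - int ((i + 2 - m) div 2) - int ((i + 2 - 2 * m) div 2)"
      unfolding H[OF i] using i assms by linarith
    ultimately show "int (hilbert2 m i) = \<lfloor>(real i + 2) / 2\<rfloor>
        - floor_star ((real i + 2 - real m) / 2) - floor_star ((real i + 2 - 2 * real m) / 2)"
      by simp
  next
    fix m' assume "m = 2 * m'"
    then obtain k where m': "m' = Suc k" and m: "m = 2 * k + 2"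
      using assms(1) by (cases m') auto
    show "?h = doubled [1..<m'] @ replicate (m + 2) m' @ doubled (rev [1..<m'])"
    proof (rule nth_equalityI)
      show "length ?h = length (doubled [1..<m'] @ replicate (m + 2) m' @ doubled (rev [1..<m']))"
        using m m' assms by simp
      fix i assume "i < length ?h"
      then have i: "i \<le> d" and "i < 6 * k + 4" using assms m by auto
      \<comment> \<open>With \<open>m' = k + 1\<close>, the three blocks have lengths \<open>2 k\<close>, \<open>2 k + 4\<close> and \<open>2 k\<close>.\<close>
      consider "i < 2 * k" | t where "i = 2 * k + t" "t < 2 * k + 4"
        | t where "i = 4 * k + 4 + t" "t < 2 * k"
      proof -
        have "i = 2 * k + (i - 2 * k) \<and> i - 2 * k < 2 * k + 4" if "\<not> i < 2 * k" "i < 4 * k + 4"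
          using that by linarith
        moreover have "i = 4 * k + 4 + (i - (4 * k + 4)) \<and> i - (4 * k + 4) < 2 * k"
          if "\<not> i < 4 * k + 4"
          using that \<open>i < 6 * k + 4\<close> by linarith
        ultimately show thesis
          using that by blast
      qed
      then have "min m (i div 2 + 1) - (i + 2 - m) div 2
          = (doubled [1..<m'] @ replicate (m + 2) m' @ doubled (rev [1..<m'])) ! i"
      proof cases
        case 1
        then have "i div 2 < k" by simp
        with 1 show ?thesis by (simp add: m m' nth_append nth_doubled del: upt_Suc)
      next
        case 2
        then have "t div 2 \<le> k + 1" by simp
        with 2 show ?thesis
          by (simp add: m m' nth_append nth_doubled del: upt_Suc replicate_Suc)
      next
        case 3
        then have "t div 2 < k" by simp
        with 3 show ?thesis
          by (simp add: m m' nth_append nth_doubled rev_nth del: upt_Suc replicate_Suc)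
      qed
      then show "?h ! i = (doubled [1..<m'] @ replicate (m + 2) m' @ doubled (rev [1..<m'])) ! i"
        by (simp only: nth_h[OF i])
    qed
  next
    fix m' assume "m = 2 * m' - 1"
    then obtain k where m': "m' = Suc k" and m: "m = 2 * k + 1"
      using assms(1) by (cases m') auto
    let ?mid = "map (\<lambda>j. if even j then m' else m' - 1) [0..<m]"
    show "?h = doubled [1..<m'] @ ?mid @ doubled (rev [1..<m'])"
    proof (rule nth_equalityI)
      show "length ?h = length (doubled [1..<m'] @ ?mid @ doubled (rev [1..<m']))"
        using m m' assms by simp
      fix i assume "i < length ?h"
      then have i: "i \<le> d" and "i < 6 * k + 1" using assms m by auto
      \<comment> \<open>With \<open>m' = k + 1\<close>, the three blocks have lengths \<open>2 k\<close>, \<open>2 k + 1\<close> and \<open>2 k\<close>.\<close>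
      consider "i < 2 * k" | t where "i = 2 * k + t" "t < 2 * k + 1"
        | t where "i = 4 * k + 1 + t" "t < 2 * k"
      proof -
        have "i = 2 * k + (i - 2 * k) \<and> i - 2 * k < 2 * k + 1" if "\<not> i < 2 * k" "i < 4 * k + 1"
          using that by linarith
        moreover have "i = 4 * k + 1 + (i - (4 * k + 1)) \<and> i - (4 * k + 1) < 2 * k"
          if "\<not> i < 4 * k + 1"
          using that \<open>i < 6 * k + 1\<close> by linarith
        ultimately show thesis
          using that by blast
      qed
      then have "min m (i div 2 + 1) - (i + 2 - m) div 2
          = (doubled [1..<m'] @ ?mid @ doubled (rev [1..<m'])) ! i"
      proof cases
        case 1
        then have "i div 2 < k" by simp
        with 1 show ?thesis by (simp add: m m' nth_append nth_doubled del: upt_Suc)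
      next
        case 2
        show ?thesis
        proof (cases "even t")
          case True
          then obtain u where "t = 2 * u" ..
          with 2 show ?thesis
            by (simp add: m m' nth_append nth_doubled del: upt_Suc)
        next
          case False
          then obtain u where "t = 2 * u + 1" ..
          with 2 show ?thesis
            by (simp add: m m' nth_append nth_doubled del: upt_Suc)
        qed
      next
        case 3
        then have "t div 2 < k" by simp
        with 3 show ?thesis
          by (simp add: m m' nth_append nth_doubled rev_nth del: upt_Suc)
      qed
      then show "?h ! i = (doubled [1..<m'] @ ?mid @ doubled (rev [1..<m'])) ! i"
        by (simp only: nth_h[OF i])
    qed
  }
  assume "m \<noteq> 1"
  show "unimodal ?h \<longleftrightarrow> even m"
  proof
    assume "even m"
    then obtain m' where m: "m = 2 * m'" ..
    \<comment> \<open>For even \<open>m\<close> the value at \<open>t\<close> depends only on \<open>t div 2\<close>, so no alternation can occur.\<close>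
    have half: "(t + 2 - m) div 2 = t div 2 + 1 - m'" for t
      unfolding m by linarith
    have rising: "min m (u + 1) - (u + 1 - m') \<le> min m (v + 1) - (v + 1 - m')"
      if "u \<le> v" "v + 1 \<le> m'" for u v
      using that m by simp
    have falling: "min m (v + 1) - (v + 1 - m') \<le> min m (u + 1) - (u + 1 - m')"
      if "u \<le> v" "m' \<le> u + 1" for u v
      unfolding min_def m using that by auto
    have nth_h': "?h ! t = min m (t div 2 + 1) - (t div 2 + 1 - m')" if "t < length ?h" for t
      using nth_h[of t] that by (simp only: half length_map length_upt)
    show "unimodal ?h"
      unfolding unimodal_iff
    proof (intro exI[of _ "m - 1"] conjI allI impI)
      fix i j assume ij: "i \<le> j" "j \<le> m - 1" and j: "j < length ?h"
      have "i div 2 \<le> j div 2" using ij by (simp add: div_le_mono)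
      moreover have "j div 2 + 1 \<le> m'" using ij m assms(1) by simp
      ultimately show "?h ! i \<le> ?h ! j"
        using rising by (simp only: nth_h'[OF j] nth_h'[OF le_less_trans[OF ij(1) j]])
    next
      fix i j assume ij: "m - 1 \<le> i" "i \<le> j" and j: "j < length ?h"
      have "i div 2 \<le> j div 2" using ij by (simp add: div_le_mono)
      moreover have "m' \<le> i div 2 + 1" using ij m by linarith
      ultimately show "?h ! j \<le> ?h ! i"
        using falling by (simp only: nth_h'[OF j] nth_h'[OF le_less_trans[OF ij(2) j]])
    qed
  next
    assume "unimodal ?h"
    then obtain k where
      up: "i \<le> j \<Longrightarrow> j \<le> k \<Longrightarrow> j < length ?h \<Longrightarrow> ?h ! i \<le> ?h ! j" and
      down: "k \<le> i \<Longrightarrow> i \<le> j \<Longrightarrow> j < length ?h \<Longrightarrow> ?h ! j \<le> ?h ! i" for i j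
      unfolding unimodal_iff by blast
    show "even m"
    proof (rule ccontr)
      assume "odd m"
      then obtain n where n: "m = 2 * n + 1" ..
      then have "n \<ge> 1" using \<open>m \<noteq> 1\<close> by simp
      then have "m + 1 \<le> d" using assms n by simp
      have "?h ! (m - 1) = n + 1" "?h ! m = n" "?h ! (m + 1) = n + 1"
        using nth_h[of "m - 1"] nth_h[of m] nth_h[of "m + 1"] \<open>m + 1 \<le> d\<close> \<open>n \<ge> 1\<close>
        unfolding n by (simp_all del: upt_Suc)
      then show False
        using up[of "m - 1" m] down[of m "m + 1"] \<open>m + 1 \<le> d\<close> by (cases "m \<le> k") auto
    qed
  qed
qed

end
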